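(* Let $\tau,\tau'\in[m]^l$ be two primitive subword patterns such that there exists a permutation $\Phi\in S_l$ with $\Phi(1)=1$, $\Phi(l)=l$ and $\tau'_i=\tau_{\Phi(i)}$ for all $i$; in other words, $\tau$ and $\tau'$ have the same number of copies of each letter, the same first letter and the same last letter. Then $\tau$ and $\tau'$ are in the same strong Wilf class: for all $k\ge1$, $n\ge0$, $r\ge0$, the number of words in $[k]^n$ containing $\tau$ exactly $r$ times equals the number containing $\tau'$ exactly $r$ times.
   Context: $[k]^n$ is the set of words of length $n$ over $\{1,\dots,k\}$. A subword pattern is a word $\tau\in[m]^l$ containing every letter of $[m]$. An occurrence of $\tau$ in $\sigma=\sigma_1\cdots\sigma_n$ is an index $i$ such that the consecutive factor $\sigma_i\cdots\sigma_{i+l-1}$ is order-isomorphic to $\tau$ (same relative order and same equalities among positions); "containing $\tau$ exactly $r$ times" means having exactly $r$ occurrences. A subword pattern is primitive if any two distinct occurrences of it (in any word) overlap in at most one letter. *)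

theory Defs
  imports Main "HOL-Combinatorics.Permutations"
begin

definition words :: "nat \<Rightarrow> nat \<Rightarrow> nat list set" where
  "words k n = {w. length w = n \<and> set w \<subseteq> {1..k}}"

definition subword_patterns :: "nat \<Rightarrow> nat \<Rightarrow> nat list set" where
  "subword_patterns m l = {\<tau> \<in> words m l. set \<tau> = {1..m}}"

definition order_isomorphic :: "nat list \<Rightarrow> nat list \<Rightarrow> bool" where
  "order_isomorphic u v \<longleftrightarrow> length u = length v \<and>
     (\<forall>i<length u. \<forall>j<length u.
        (u ! i < u ! j \<longleftrightarrow> v ! i < v ! j) \<and> (u ! i = u ! j \<longleftrightarrow> v ! i = v ! j))"

text \<open>Positions are counted from 0.\<close>

definition occurrences :: "nat list \<Rightarrow> nat list \<Rightarrow> nat set" where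
  "occurrences \<tau> \<sigma> = {i. i + length \<tau> \<le> length \<sigma> \<and>
     order_isomorphic (take (length \<tau>) (drop i \<sigma>)) \<tau>}"

text \<open>The overlap of two occurrences is measured in positions of the ambient word.\<close>

definition primitive :: "nat list \<Rightarrow> bool" where
  "primitive \<tau> \<longleftrightarrow> (\<forall>k n. \<forall>\<sigma>\<in>words k n. \<forall>i\<in>occurrences \<tau> \<sigma>. \<forall>j\<in>occurrences \<tau> \<sigma>.
     i \<noteq> j \<longrightarrow> card ({i..<i + length \<tau>} \<inter> {j..<j + length \<tau>}) \<le> 1)"

definition words_containing :: "nat list \<Rightarrow> nat \<Rightarrow> nat \<Rightarrow> nat \<Rightarrow> nat list set" where
  "words_containing \<tau> r k n = {\<sigma> \<in> words k n. card (occurrences \<tau> \<sigma>) = r}"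

definition strongly_Wilf_equivalent :: "nat list \<Rightarrow> nat list \<Rightarrow> bool" where
  "strongly_Wilf_equivalent \<tau> \<tau>' \<longleftrightarrow>
     (\<forall>k\<ge>1. \<forall>n r. card (words_containing \<tau> r k n) = card (words_containing \<tau>' r k n))"

end

theory Submission
  imports Defs
begin

text \<open>
  For a set \<open>S\<close> of positions, count the words in which every element of \<open>S\<close> is an occurrence
  of \<open>\<tau>\<close>, other occurrences being allowed. Primitivity makes the factors at \<open>S\<close> share at most
  end letters, and \<open>\<Phi>\<close> fixes the ends, so \<open>\<Phi>\<close> can be applied inside all these factors at once.
  This permutes the letters of the word and turns the marked occurrences of \<open>\<tau>\<close> into occurrences
  of \<open>\<tau>'\<close>, so both patterns give the same count for each \<open>S\<close>. By inclusion-exclusion the numbers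
  of words whose set of occurrences is exactly \<open>S\<close> agree as well.
\<close>

text \<open>Stated for a general \<open>P\<close> because it serves twice: with \<open>P\<close>
  demanding a superset of a given set, and with \<open>P\<close> fixing the cardinality.\<close>

lemma card_Collect_eq_sum_fibres:
  assumes "finite X" "finite U" "\<And>x. x \<in> X \<Longrightarrow> f x \<subseteq> U"
  shows "card {x \<in> X. P (f x)} = (\<Sum>T\<in>{T. T \<subseteq> U \<and> P T}. card {x \<in> X. f x = T})"
proof -
  have "{x \<in> X. P (f x)} = (\<Union>T\<in>{T. T \<subseteq> U \<and> P T}. {x \<in> X. f x = T})"
    using assms(3) by auto
  also have "card \<dots> = (\<Sum>T\<in>{T. T \<subseteq> U \<and> P T}. card {x \<in> X. f x = T})"
    by (rule card_UN_disjoint) (use assms(1,2) in auto)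
  finally show ?thesis .
qed

text \<open>Inclusion-exclusion without signs: the count for \<open>S \<subseteq> f x\<close> is the
  sum of the fibres over all supersets of \<open>S\<close> in \<open>U\<close>. By induction
  downwards from \<open>U\<close> the fibres over proper supersets agree, and cancelling them leaves
  the fibre over \<open>S\<close>.\<close>

lemma card_fibres_eqI:
  assumes X: "finite X" and U: "finite U"
    and f: "\<And>x. x \<in> X \<Longrightarrow> f x \<subseteq> U" and g: "\<And>x. x \<in> X \<Longrightarrow> g x \<subseteq> U"
    and eq: "\<And>S. S \<subseteq> U \<Longrightarrow> card {x \<in> X. S \<subseteq> f x} = card {x \<in> X. S \<subseteq> g x}"
    and "S \<subseteq> U"
  shows "card {x \<in> X. f x = S} = card {x \<in> X. g x = S}"
  using \<open>S \<subseteq> U\<close>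
proof (induction "card (U - S)" arbitrary: S rule: less_induct)
  case less
  let ?A = "{T. T \<subseteq> U \<and> S \<subseteq> T}"
  have fin: "finite ?A" and mem: "S \<in> ?A" using U less.prems by auto
  have rest: "card {x \<in> X. f x = T} = card {x \<in> X. g x = T}" if "T \<in> ?A - {S}" for T
  proof (rule less.hyps)
    have "U - T \<subset> U - S" using that by auto
    then show "card (U - T) < card (U - S)" using U by (intro psubset_card_mono) auto
  qed (use that in auto)
  have "card {x \<in> X. h x = S} + (\<Sum>T\<in>?A - {S}. card {x \<in> X. h x = T})
      = card {x \<in> X. S \<subseteq> h x}" if "\<And>x. x \<in> X \<Longrightarrow> h x \<subseteq> U" for h
    using card_Collect_eq_sum_fibres[where P = "\<lambda>T. S \<subseteq> T", OF X U that]
      sum.remove[OF fin mem, of "\<lambda>T. card {x \<in> X. h x = T}"]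
    by simp
  from this[of f] this[of g] f g eq[OF less.prems] sum.cong[OF refl rest, of "?A - {S}" "\<lambda>T. T"]
  show ?case by simp
qed

text \<open>Only positions strictly inside a block are moved, because an end, \<open>i\<close> or
  \<open>i + l - 1\<close>, may be shared with a neighbouring block. Under \<open>spaced l S\<close>
  the interiors are disjoint, so \<open>THE\<close> has a unique candidate.\<close>

definition block_perm :: "nat \<Rightarrow> (nat \<Rightarrow> nat) \<Rightarrow> nat set \<Rightarrow> nat \<Rightarrow> nat" where
  "block_perm l \<Phi> S p =
     (if \<exists>i\<in>S. i < p \<and> p + 1 < i + l
      then let i = THE i. i \<in> S \<and> i < p \<and> p + 1 < i + l in i + \<Phi> (p - i) else p)"

text \<open>Sharing one letter is still allowed: \<open>j\<close> may equal
  \<open>i + l - 1\<close>. The 1 is added on the right to avoid truncated subtraction.\<close>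

definition spaced :: "nat \<Rightarrow> nat set \<Rightarrow> bool" where
  "spaced l S \<longleftrightarrow> (\<forall>i\<in>S. \<forall>j\<in>S. i < j \<longrightarrow> i + l \<le> j + 1)"

lemma block_perm_interior:
  assumes "spaced l S" "i \<in> S" "i < p" "p + 1 < i + l"
  shows "block_perm l \<Phi> S p = i + \<Phi> (p - i)"
proof -
  have uniq: "j = i" if "j \<in> S" "j < p" "p + 1 < j + l" for j
  proof -
    have "i < j \<Longrightarrow> i + l \<le> j + 1" "j < i \<Longrightarrow> j + l \<le> i + 1"
      using assms(1,2) that(1) unfolding spaced_def by blast+
    then show ?thesis using assms(3,4) that(2,3) by linarith
  qed
  have "(THE i. i \<in> S \<and> i < p \<and> p + 1 < i + l) = i"
    by (rule the_equality) (use assms uniq in blast)+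
  moreover have "\<exists>i\<in>S. i < p \<and> p + 1 < i + l" using assms by blast
  ultimately show ?thesis unfolding block_perm_def Let_def by simp
qed

text \<open>At the ends \<open>j = 0\<close> and \<open>j = l - 1\<close>, spacing keeps
  \<open>i + j\<close> out of the interior of every block, so it stays fixed, in agreement with
  \<open>\<Phi>\<close>. Hence one formula covers the whole block.\<close>

lemma block_perm_block:
  assumes sp: "spaced l S" and i: "i \<in> S" and j: "j < l"
    and ends: "\<Phi> 0 = 0" "\<Phi> (l - 1) = l - 1"
  shows "block_perm l \<Phi> S (i + j) = i + \<Phi> j"
proof (cases "0 < j \<and> j + 1 < l")
  case True
  then show ?thesis using block_perm_interior[OF sp i, of "i + j"] by simp
next
  case False
  then have end_j: "j = 0 \<or> j = l - 1" using j by auto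
  have "\<not> (a < i + j \<and> i + j + 1 < a + l)" if "a \<in> S" for a
  proof -
    have "a < i \<Longrightarrow> a + l \<le> i + 1" "i < a \<Longrightarrow> i + l \<le> a + 1"
      using sp i that unfolding spaced_def by blast+
    then show ?thesis using end_j j by linarith
  qed
  then have "block_perm l \<Phi> S (i + j) = i + j" unfolding block_perm_def by auto
  then show ?thesis using end_j ends by auto
qed

lemma permutes_interior:
  fixes j l :: nat
  assumes "\<Phi> permutes {0..<l}" "\<Phi> 0 = 0" "\<Phi> (l - 1) = l - 1" "0 < j" "j + 1 < l"
  shows "0 < \<Phi> j \<and> \<Phi> j + 1 < l"
proof -
  have "inj \<Phi>" using assms(1) by (rule permutes_inj)
  then have "\<Phi> j \<noteq> \<Phi> 0" "\<Phi> j \<noteq> \<Phi> (l - 1)" using assms(4,5) by (auto simp: inj_eq)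
  moreover have "\<Phi> j < l" using permutes_in_image[OF assms(1), of j] assms(5) by auto
  ultimately show ?thesis using assms(2,3) by auto
qed

text \<open>Since \<open>\<Phi>\<close> fixes both ends, it maps the interior of a block to itself.
  An interior position is reached through \<open>inv \<Phi>\<close> within its block; every other
  position is its own preimage.\<close>

lemma block_perm_image:
  assumes sp: "spaced l S" and S: "\<And>i. i \<in> S \<Longrightarrow> i + l \<le> n"
    and \<Phi>: "\<Phi> permutes {0..<l}" and ends: "\<Phi> 0 = 0" "\<Phi> (l - 1) = l - 1"
  shows "block_perm l \<Phi> S ` {..<n} = {..<n}"
proof -
  have sub: "block_perm l \<Phi> S p < n" if "p < n" for p
  proof (cases "\<exists>i\<in>S. i < p \<and> p + 1 < i + l")
    case True
    then obtain i where i: "i \<in> S" "i < p" "p + 1 < i + l" by auto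
    then show ?thesis
      using block_perm_interior[OF sp i, of \<Phi>] permutes_interior[OF \<Phi> ends, of "p - i"] S[of i]
      by linarith
  qed (use that in \<open>auto simp: block_perm_def\<close>)
  have "q \<in> block_perm l \<Phi> S ` {..<n}" if q: "q < n" for q
  proof (cases "\<exists>i\<in>S. i < q \<and> q + 1 < i + l")
    case True
    then obtain i where i: "i \<in> S" "i < q" "q + 1 < i + l" by auto
    have inv: "inv \<Phi> permutes {0..<l}" "inv \<Phi> 0 = 0" "inv \<Phi> (l - 1) = l - 1"
      using permutes_inv[OF \<Phi>] ends permutes_inv_eq[OF \<Phi>] by auto
    let ?j = "inv \<Phi> (q - i)"
    have j: "0 < ?j" "?j + 1 < l"
      using permutes_interior[OF inv, of "q - i"] i by auto
    have "block_perm l \<Phi> S (i + ?j) = i + \<Phi> ?j"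
      using block_perm_interior[OF sp i(1), of "i + ?j"] j by simp
    also have "\<dots> = q" using permutes_inverses(1)[OF \<Phi>] i(2) by simp
    finally show ?thesis using j S[OF i(1)] by (intro image_eqI[of _ _ "i + ?j"]) auto
  next
    case False
    then show ?thesis using q by (intro image_eqI[of _ _ q]) (auto simp: block_perm_def)
  qed
  then show ?thesis using sub by auto
qed

lemma finite_words: "finite (words k n)"
proof -
  have "words k n = {w. set w \<subseteq> {1..k} \<and> length w = n}" unfolding words_def by auto
  then show ?thesis using finite_lists_length_eq[of "{1..k}" n] by simp
qed

lemma primitive_imp_spaced:
  assumes "primitive \<tau>" "\<sigma> \<in> words k n" "S \<subseteq> occurrences \<tau> \<sigma>"
  shows "spaced (length \<tau>) S"
  unfolding spaced_def
proof (intro ballI impI)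
  fix i j assume "i \<in> S" "j \<in> S" "i < j"
  then have "card ({i..<i + length \<tau>} \<inter> {j..<j + length \<tau>}) \<le> 1"
    using assms unfolding primitive_def by (metis less_irrefl subsetD)
  moreover have "{i..<i + length \<tau>} \<inter> {j..<j + length \<tau>} = {j..<i + length \<tau>}"
    using \<open>i < j\<close> by auto
  ultimately have "card {j..<i + length \<tau>} \<le> 1" by (simp only:)
  then show "i + length \<tau> \<le> j + 1" by simp
qed

text \<open>An injection that rearranges letters is enough: exchanging the patterns and replacing
  \<open>\<Phi>\<close> by its inverse yields the reverse inequality.\<close>

lemma card_marked_le:
  assumes len: "length \<tau> = l" "length \<tau>' = l" and prim: "primitive \<tau>"
    and \<Phi>: "\<Phi> permutes {0..<l}" and ends: "\<Phi> 0 = 0" "\<Phi> (l - 1) = l - 1"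
    and \<tau>': "\<forall>i<l. \<tau>' ! i = \<tau> ! \<Phi> i"
  shows "card {\<sigma> \<in> words k n. S \<subseteq> occurrences \<tau> \<sigma>} \<le> card {\<sigma> \<in> words k n. S \<subseteq> occurrences \<tau>' \<sigma>}"
    (is "card ?A \<le> card ?B")
\<comment> \<open>A word in \<open>?A\<close> guarantees that \<open>S\<close> is spaced and that
  its blocks fit into length \<open>n\<close>; without one the left side is 0.\<close>
proof (cases "?A = {}")
  case True
  then show ?thesis by (metis card.empty le0)
next
  case False
  then obtain \<sigma>\<^sub>0 where \<sigma>\<^sub>0: "\<sigma>\<^sub>0 \<in> words k n" "S \<subseteq> occurrences \<tau> \<sigma>\<^sub>0" by auto
  have sp: "spaced l S" using primitive_imp_spaced[OF prim \<sigma>\<^sub>0] len by simp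
  have S: "i + l \<le> n" if "i \<in> S" for i
    using \<sigma>\<^sub>0 that len unfolding words_def occurrences_def by auto
  define \<pi> where "\<pi> = block_perm l \<Phi> S"
  define F where "F \<sigma> = map (\<lambda>p. \<sigma> ! \<pi> p) [0..<n]" for \<sigma> :: "nat list"
  have im: "\<pi> ` {..<n} = {..<n}" unfolding \<pi>_def by (rule block_perm_image[OF sp S \<Phi> ends])
  have \<Phi>l: "\<Phi> a < l" if "a < l" for a using permutes_in_image[OF \<Phi>, of a] that by auto
  show ?thesis
  proof (rule card_inj_on_le)
    show "finite ?B" using finite_words by simp
    show "inj_on F ?A"
    proof (rule inj_onI)
      fix u v assume "u \<in> ?A" "v \<in> ?A" and eq: "F u = F v"
      then have l: "length u = n" "length v = n" by (auto simp: words_def)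
      show "u = v"
      proof (rule nth_equalityI)
        fix q assume "q < length u"
        \<comment> \<open>Surjectivity of \<open>\<pi>\<close> means that each letter of
          \<open>u\<close> can be read off somewhere in \<open>F u\<close>.\<close>
        then have "q \<in> \<pi> ` {..<n}" using im l by simp
        then obtain p where "p < n" "q = \<pi> p" by auto
        then show "u ! q = v ! q" using arg_cong[OF eq, of "\<lambda>w. w ! p"] by (simp add: F_def)
      qed (use l in simp)
    qed
    show "F ` ?A \<subseteq> ?B"
    proof (rule image_subsetI)
      fix \<sigma> assume \<sigma>: "\<sigma> \<in> ?A"
      then have l\<sigma>: "length \<sigma> = n" by (simp add: words_def)
      have "\<sigma> ! \<pi> p \<in> set \<sigma>" if "p < n" for p using im that l\<sigma> by (metis imageI lessThan_iff nth_mem)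
      then have "F \<sigma> \<in> words k n" using \<sigma> by (auto simp: F_def words_def)
      moreover have "i \<in> occurrences \<tau>' (F \<sigma>)" if i: "i \<in> S" for i
      proof -
        have "order_isomorphic (take l (drop i \<sigma>)) \<tau>"
          using \<sigma> i len unfolding occurrences_def by auto
        then have iso: "(\<sigma> ! (i + a) < \<sigma> ! (i + b) \<longleftrightarrow> \<tau> ! a < \<tau> ! b) \<and>
            (\<sigma> ! (i + a) = \<sigma> ! (i + b) \<longleftrightarrow> \<tau> ! a = \<tau> ! b)" if "a < l" "b < l" for a b
          using that S[OF i] l\<sigma> unfolding order_isomorphic_def by simp
        have nth: "F \<sigma> ! (i + a) = \<sigma> ! (i + \<Phi> a)" if "a < l" for a
          using that S[OF i] block_perm_block[OF sp i that ends] by (simp add: F_def \<pi>_def)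
        \<comment> \<open>Here \<open>iso\<close> is used at \<open>\<Phi> a\<close> and
          \<open>\<Phi> b\<close>, where the letters of \<open>\<tau>\<close> are
          \<open>\<tau>' ! a\<close> and \<open>\<tau>' ! b\<close>.\<close>
        have "order_isomorphic (take l (drop i (F \<sigma>))) \<tau>'"
          using S[OF i] len \<tau>' \<Phi>l iso nth unfolding order_isomorphic_def by (simp add: F_def)
        then show ?thesis using S[OF i] len by (simp add: occurrences_def F_def)
      qed
      ultimately show "F \<sigma> \<in> ?B" by auto
    qed
  qed
qed

theorem theorem4p1:
  fixes \<tau> \<tau>' :: "nat list" and m l :: nat and \<Phi> :: "nat \<Rightarrow> nat"
  assumes "\<tau> \<in> subword_patterns m l" and "\<tau>' \<in> subword_patterns m l"
    and "primitive \<tau>" and "primitive \<tau>'"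
    and "\<Phi> permutes {0..<l}" and "\<Phi> 0 = 0" and "\<Phi> (l - 1) = l - 1"
    and "\<forall>i<l. \<tau>' ! i = \<tau> ! \<Phi> i"
  shows "strongly_Wilf_equivalent \<tau> \<tau>'"
  unfolding strongly_Wilf_equivalent_def
proof (intro allI impI)
  fix k n r :: nat
  have len: "length \<tau> = l" "length \<tau>' = l"
    using assms(1,2) by (auto simp: subword_patterns_def words_def)
  note \<Phi> = assms(5)
  have inv: "inv \<Phi> permutes {0..<l}" "inv \<Phi> 0 = 0" "inv \<Phi> (l - 1) = l - 1"
    using permutes_inv[OF \<Phi>] assms(6,7) permutes_inv_eq[OF \<Phi>] by auto
  have \<tau>: "\<forall>i<l. \<tau> ! i = \<tau>' ! inv \<Phi> i"
    using assms(8) permutes_inverses(1)[OF \<Phi>] permutes_in_image[OF inv(1)] by auto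
  have marked: "card {\<sigma> \<in> words k n. S \<subseteq> occurrences \<tau> \<sigma>}
      = card {\<sigma> \<in> words k n. S \<subseteq> occurrences \<tau>' \<sigma>}" for S
    using card_marked_le[OF len assms(3,5-8)] card_marked_le[OF len(2,1) assms(4) inv \<tau>]
    by (rule antisym)
  \<comment> \<open>One finite universe serves both patterns; the start \<open>n\<close> itself can
    arise only for the empty pattern.\<close>
  have occ: "occurrences \<rho> \<sigma> \<subseteq> {..n}" if "\<sigma> \<in> words k n" for \<rho> \<sigma>
    using that by (auto simp: occurrences_def words_def)
  have count: "card (words_containing \<rho> r k n)
      = (\<Sum>T\<in>{T. T \<subseteq> {..n} \<and> card T = r}. card {\<sigma> \<in> words k n. occurrences \<rho> \<sigma> = T})" for \<rho>
    unfolding words_containing_def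
    by (rule card_Collect_eq_sum_fibres[OF finite_words _ occ]) simp
  show "card (words_containing \<tau> r k n) = card (words_containing \<tau>' r k n)"
    unfolding count
    by (intro sum.cong refl card_fibres_eqI[OF finite_words _ occ occ marked]) auto
qed

end
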